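(* Let $\mathbb{F}$ be a field. Every $3$-dimensional simple anticommutative algebra over $\mathbb{F}$ is isomorphic to the outside Yau's twist of the simple Lie algebra $\mathfrak{so}(3,\mathbb{F})$ with respect to some bijective linear map. In addition, $\mathcal{RS}_3\subsetneq\mathcal{PS}_3=\mathcal{SS}^*_3=\mathcal{SS}_3=\mathcal{MS}_3$.
   Context: An anticommutative algebra over $\mathbb{F}$ is a vector space $A$ with a bilinear product $[\cdot,\cdot]$ satisfying $[x,x]=0$ for all $x$; it is abelian if the product is zero, and simple if it is not abelian and its only ideals are $0$ and $A$. $\mathfrak{so}(3,\mathbb{F})$ is the Lie algebra with basis $e_1,e_2,e_3$ and $[e_1,e_2]=e_3$, $[e_2,e_3]=e_1$, $[e_3,e_1]=e_2$. The outside Yau's twist of a Lie algebra $(L,[\cdot,\cdot])$ with respect to a linear map $\theta:L\to L$ is the algebra $(L,\theta\circ[\cdot,\cdot])$. $\mathrm{HS}(A)$ denotes the set of twisting maps of $A$, i.e. linear maps $\sigma:A\to A$ with $[\sigma(x),[y,z]]+[\sigma(y),[z,x]]+[\sigma(z),[x,y]]=0$ for all $x,y,z\in A$; for such $\sigma$, $(A,[\cdot,\cdot],\sigma)$ is a Hom-Lie algebra. It is multiplicative if $\sigma([x,y])=[\sigma(x),\sigma(y)]$ for all $x,y$, and regular if $\sigma$ is an automorphism of $(A,[\cdot,\cdot])$. A Hom-ideal is a subspace $I$ with $[I,A]\subset I$ and $\sigma(I)\subset I$; a Hom-Lie algebra is simple if it is not abelian and its only Hom-ideals are $0$ and $A$.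 Classes of finite-dimensional anticommutative algebras over $\mathbb{F}$: $\mathcal{SS}$ (strongly simple) consists of the nonabelian $A$ such that $(A,[\cdot,\cdot],\sigma)$ is simple for every $\sigma\in\mathrm{HS}(A)$; $\mathcal{SS}^*$ (strongly$^*$ simple) of those $A\in\mathcal{SS}$ with $\mathrm{HS}(A)\ne\{0\}$; $\mathcal{PS}$ (pure strongly simple) of those $A\in\mathcal{SS}$ such that $\mathrm{HS}(A)$ contains a bijective map; $\mathcal{MS}$ of the $A$ having at least one twisting map $\sigma$ making $(A,[\cdot,\cdot],\sigma)$ a multiplicative simple Hom-Lie algebra; $\mathcal{RS}$ of the $A$ having at least one twisting map $\sigma$ making $(A,[\cdot,\cdot],\sigma)$ a regular simple Hom-Lie algebra. The subscript $3$ denotes the subclass of algebras of dimension $3$. *)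

theory Defs
  imports "HOL-Analysis.Cartesian_Space"
begin

text \<open>The underlying vector space is all of the type \<open>'a\<close>, with the addition of its type
  class and the scalar multiplication \<open>scl\<close>. Each class of algebras below is therefore given by
  its members on one type \<open>'a\<close>; a statement about a whole class quantifies over \<open>'a\<close>.\<close>

record ('f, 'a) algebra =
  scl :: "'f \<Rightarrow> 'a \<Rightarrow> 'a"
  brk :: "'a \<Rightarrow> 'a \<Rightarrow> 'a"

definition linear_map ::
  "('f::field, 'a::ab_group_add) algebra \<Rightarrow> ('f, 'b::ab_group_add) algebra \<Rightarrow> ('a \<Rightarrow> 'b) \<Rightarrow> bool"
  where "linear_map A B f \<longleftrightarrow> Vector_Spaces.linear (scl A) (scl B) f"

definition anticommutative :: "('f::field, 'a::ab_group_add) algebra \<Rightarrow> bool"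
  where "anticommutative A \<longleftrightarrow>
    vector_space (scl A) \<and>
    (\<forall>x. linear_map A A (\<lambda>y. brk A x y)) \<and>
    (\<forall>y. linear_map A A (\<lambda>x. brk A x y)) \<and>
    (\<forall>x. brk A x x = 0)"

definition lie_algebra :: "('f::field, 'a::ab_group_add) algebra \<Rightarrow> bool"
  where "lie_algebra A \<longleftrightarrow> anticommutative A \<and>
    (\<forall>x y z. brk A x (brk A y z) + brk A y (brk A z x) + brk A z (brk A x y) = 0)"

definition finite_dim :: "('f::field, 'a::ab_group_add) algebra \<Rightarrow> bool"
  where "finite_dim A \<longleftrightarrow> (\<exists>B. finite_dimensional_vector_space (scl A) B)"

definition dimension :: "('f::field, 'a::ab_group_add) algebra \<Rightarrow> nat"
  where "dimension A = vector_space.dim (scl A) UNIV"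

definition isomorphic ::
  "('f::field, 'a::ab_group_add) algebra \<Rightarrow> ('f, 'b::ab_group_add) algebra \<Rightarrow> bool"
  where "isomorphic A B \<longleftrightarrow>
    (\<exists>\<phi>. linear_map A B \<phi> \<and> bij \<phi> \<and> (\<forall>x y. \<phi> (brk A x y) = brk B (\<phi> x) (\<phi> y)))"

definition abelian :: "('f::field, 'a::ab_group_add) algebra \<Rightarrow> bool"
  where "abelian A \<longleftrightarrow> (\<forall>x y. brk A x y = 0)"

definition ideal :: "('f::field, 'a::ab_group_add) algebra \<Rightarrow> 'a set \<Rightarrow> bool"
  where "ideal A I \<longleftrightarrow> module.subspace (scl A) I \<and> (\<forall>x\<in>I. \<forall>y. brk A x y \<in> I)"

definition simple :: "('f::field, 'a::ab_group_add) algebra \<Rightarrow> bool"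
  where "simple A \<longleftrightarrow> \<not> abelian A \<and> (\<forall>I. ideal A I \<longrightarrow> I = {0} \<or> I = UNIV)"

definition yau_twist ::
  "('f::field, 'a::ab_group_add) algebra \<Rightarrow> ('a \<Rightarrow> 'a) \<Rightarrow> ('f, 'a) algebra"
  where "yau_twist L \<theta> = L\<lparr>brk := (\<lambda>x y. \<theta> (brk L x y))\<rparr>"

text \<open>The coordinates are those with respect to the basis
  \<open>e\<^sub>i = axis i 1\<close>; the structure constants are checked in \<open>so3_basis\<close>.\<close>

definition so3 :: "('f::field, 'f^3) algebra"
  where "so3 = \<lparr>scl = (*s),
    brk = (\<lambda>x y. vector [x$2 * y$3 - x$3 * y$2, x$3 * y$1 - x$1 * y$3, x$1 * y$2 - x$2 * y$1])\<rparr>"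

definition HS :: "('f::field, 'a::ab_group_add) algebra \<Rightarrow> ('a \<Rightarrow> 'a) set"
  where "HS A = {\<sigma>. linear_map A A \<sigma> \<and>
    (\<forall>x y z. brk A (\<sigma> x) (brk A y z) + brk A (\<sigma> y) (brk A z x) + brk A (\<sigma> z) (brk A x y) = 0)}"

definition hom_ideal :: "('f::field, 'a::ab_group_add) algebra \<Rightarrow> ('a \<Rightarrow> 'a) \<Rightarrow> 'a set \<Rightarrow> bool"
  where "hom_ideal A \<sigma> I \<longleftrightarrow>
    module.subspace (scl A) I \<and> (\<forall>x\<in>I. \<forall>y. brk A x y \<in> I) \<and> \<sigma> ` I \<subseteq> I"

definition hom_simple :: "('f::field, 'a::ab_group_add) algebra \<Rightarrow> ('a \<Rightarrow> 'a) \<Rightarrow> bool"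
  where "hom_simple A \<sigma> \<longleftrightarrow> \<not> abelian A \<and> (\<forall>I. hom_ideal A \<sigma> I \<longrightarrow> I = {0} \<or> I = UNIV)"

definition multiplicative :: "('f::field, 'a::ab_group_add) algebra \<Rightarrow> ('a \<Rightarrow> 'a) \<Rightarrow> bool"
  where "multiplicative A \<sigma> \<longleftrightarrow> (\<forall>x y. \<sigma> (brk A x y) = brk A (\<sigma> x) (\<sigma> y))"

definition regular :: "('f::field, 'a::ab_group_add) algebra \<Rightarrow> ('a \<Rightarrow> 'a) \<Rightarrow> bool"
  where "regular A \<sigma> \<longleftrightarrow> linear_map A A \<sigma> \<and> bij \<sigma> \<and> multiplicative A \<sigma>"

definition SS :: "('f::field, 'a::ab_group_add) algebra set"
  where "SS = {A. anticommutative A \<and> finite_dim A \<and> \<not> abelian A \<and> (\<forall>\<sigma>\<in>HS A. hom_simple A \<sigma>)}"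

definition SS_star :: "('f::field, 'a::ab_group_add) algebra set"
  where "SS_star = {A \<in> SS. HS A \<noteq> {\<lambda>x. 0}}"

definition PS :: "('f::field, 'a::ab_group_add) algebra set"
  where "PS = {A \<in> SS. \<exists>\<sigma>\<in>HS A. bij \<sigma>}"

definition MS :: "('f::field, 'a::ab_group_add) algebra set"
  where "MS = {A. anticommutative A \<and> finite_dim A \<and>
    (\<exists>\<sigma>\<in>HS A. multiplicative A \<sigma> \<and> hom_simple A \<sigma>)}"

definition RS :: "('f::field, 'a::ab_group_add) algebra set"
  where "RS = {A. anticommutative A \<and> finite_dim A \<and>
    (\<exists>\<sigma>\<in>HS A. regular A \<sigma> \<and> hom_simple A \<sigma>)}"

definition of_dim ::
  "nat \<Rightarrow> ('f::field, 'a::ab_group_add) algebra set \<Rightarrow> ('f, 'a) algebra set"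
  where "of_dim n C = {A \<in> C. dimension A = n}"

lemma so3_basis:
  "brk so3 (axis 1 1) (axis 2 1) = (axis 3 1 :: 'f::field^3)"
  "brk so3 (axis 2 1) (axis 3 1) = (axis 1 1 :: 'f::field^3)"
  "brk so3 (axis 3 1) (axis 1 1) = (axis 2 1 :: 'f::field^3)"
  by (simp_all add: so3_def vec_eq_iff forall_3 axis_def)

lemma lie_algebra_so3: "lie_algebra (so3 :: ('f::field, 'f^3) algebra)"
proof -
  have vs: "vector_space ((*s) :: 'f \<Rightarrow> 'f^3 \<Rightarrow> 'f^3)"
    by (rule vec.vector_space_axioms)
  have "linear_map so3 so3 (\<lambda>y. brk so3 x y)"
    "linear_map so3 so3 (\<lambda>y. brk so3 y x)" for x :: "'f^3"
    unfolding linear_map_def so3_def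
    by (auto intro!: Vector_Spaces.linear.intro vs module_hom.intro vec.module_axioms
        module_hom_axioms.intro simp: linear_def module_hom_iff vs vec.module_axioms
        vec_eq_iff forall_3 algebra_simps)
  moreover have "brk so3 x x = 0" for x :: "'f^3"
    by (simp add: so3_def vec_eq_iff forall_3)
  moreover have "brk so3 x (brk so3 y z) + brk so3 y (brk so3 z x) + brk so3 z (brk so3 x y) = 0"
    for x y z :: "'f^3"
    by (simp add: so3_def vec_eq_iff forall_3 algebra_simps)
  ultimately show ?thesis
    using vs by (auto simp: lie_algebra_def anticommutative_def) (simp add: so3_def)
qed

lemma dimension_so3: "dimension (so3 :: ('f::field, 'f^3) algebra) = 3"
  by (simp add: dimension_def so3_def vec.dim_UNIV card_cart_basis)

lemma simple_so3: "simple (so3 :: ('f::field, 'f^3) algebra)"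
proof -
  let ?b = "brk (so3 :: ('f, 'f^3) algebra)"
  have coord: "?b x y $ 1 = x$2 * y$3 - x$3 * y$2" "?b x y $ 2 = x$3 * y$1 - x$1 * y$3"
    "?b x y $ 3 = x$1 * y$2 - x$2 * y$1" for x y
    by (simp_all add: so3_def)
  have "I = UNIV" if I: "ideal so3 I" and "I \<noteq> {0}" for I :: "('f^3) set"
  proof -
    have sub: "vec.subspace I" and br: "\<And>x y. x \<in> I \<Longrightarrow> ?b x y \<in> I"
      using I by (auto simp: ideal_def so3_def)
    obtain x where x: "x \<in> I" "x \<noteq> 0"
      using sub \<open>I \<noteq> {0}\<close> vec.subspace_0 by blast
    have *: "axis i 1 \<in> I" if "c *s axis i 1 \<in> I" "c \<noteq> 0" for c :: 'f and i
      using vec.subspace_scale[OF sub that(1), of "inverse c"] that(2) by simp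
    let ?e1 = "axis 1 1 :: 'f^3" and ?e2 = "axis 2 1 :: 'f^3" and ?e3 = "axis 3 1 :: 'f^3"
    have a: "?b (?b x ?e1) ?e2 = (x$2) *s ?e1"
      "?b (?b x ?e2) ?e3 = (x$3) *s ?e2"
      "?b (?b x ?e3) ?e1 = (x$1) *s ?e3"
      by (simp_all add: vec_eq_iff forall_3 coord) (simp_all add: axis_def)
    have "x$1 \<noteq> 0 \<or> x$2 \<noteq> 0 \<or> x$3 \<noteq> 0"
      using x(2) by (auto simp: vec_eq_iff forall_3)
    then have "?e1 \<in> I \<or> ?e2 \<in> I \<or> ?e3 \<in> I"
      using a br x(1) * by metis
    then have e: "?e1 \<in> I" "?e2 \<in> I" "?e3 \<in> I"
      using br so3_basis by metis+
    have "y \<in> I" for y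
    proof -
      have "y = y$1 *s ?e1 + y$2 *s ?e2 + y$3 *s ?e3"
        by (simp add: vec_eq_iff forall_3 axis_def)
      then show ?thesis
        using e sub by (metis vec.subspace_add vec.subspace_scale)
    qed
    then show ?thesis by auto
  qed
  moreover have "\<not> abelian (so3 :: ('f, 'f^3) algebra)"
    unfolding abelian_def using so3_basis(1) by (metis axis_eq_0_iff zero_neq_one)
  ultimately show ?thesis by (auto simp: simple_def)
qed

end

theory Submission
  imports Defs "HOL-Analysis.Determinants"
begin

text \<open>In dimension 3 an alternating bilinear product factors through the cross product: in coordinates,
  \<open>[x,y] = M(x \<times> y)\<close> for a matrix \<open>M\<close>. The algebra is simple iff \<open>M\<close> is invertible. For a multiplicative
  simple Hom-Lie algebra the derived subspace is a nonzero Hom-ideal, so it is everything and \<open>M\<close> is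
  invertible; conversely \<open>0\<close> is a multiplicative twisting map. If \<open>M\<close> is invertible, the identity
  \<open>M\<^sup>T(Mx \<times> My) = det M (x \<times> y)\<close> and the Jacobi identity for \<open>\<times>\<close> make \<open>M\<^sup>-\<^sup>T\<close> a bijective twisting map.
  An automorphism \<open>\<sigma>\<close> that is also a twisting map must satisfy \<open>\<sigma>\<^sup>2 = M M\<^sup>-\<^sup>T\<close> and \<open>\<sigma> M\<^sup>T = M \<sigma>\<^sup>T\<close>,
  which is impossible for a suitable \<open>M\<close>.\<close>

section \<open>Cross product and linear functionals over a field\<close>

lemma linear_map_iff:
  "linear_map A B f \<longleftrightarrow> vector_space (scl A) \<and> vector_space (scl B) \<and>
     (\<forall>x y. f (x + y) = f x + f y) \<and> (\<forall>c x. f (scl A c x) = scl B c (f x))"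
  by (auto simp: linear_map_def Vector_Spaces.linear_def module_hom_iff module_iff_vector_space)

lemma scl_so3 [simp]: "scl so3 = (*s)"
  by (simp add: so3_def)

lemma brk_so3_nth [simp]:
  "brk so3 x y $ 1 = x$2 * y$3 - x$3 * y$2"
  "brk so3 x y $ 2 = x$3 * y$1 - x$1 * y$3"
  "brk so3 x y $ 3 = x$1 * y$2 - x$2 * y$1"
  by (simp_all add: so3_def)

lemma matrix_vector_mult_nth_3:
  fixes M :: "'f::comm_ring_1^3^'m"
  shows "(M *v x) $ i = M$i$1 * x$1 + M$i$2 * x$2 + M$i$3 * x$3"
  by (simp add: matrix_vector_mult_def sum_3)

text \<open>Paired with any \<open>z\<close>, both sides give the determinant with columns
  \<open>M *v x\<close>, \<open>M *v y\<close>, \<open>M *v z\<close>. No inverse of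
  \<open>M\<close> enters, so the identity is polynomial.\<close>

lemma transpose_mult_brk_so3:
  fixes M :: "'f::field^3^3"
  shows "transpose M *v brk so3 (M *v x) (M *v y) = det M *s brk so3 x y"
  by (simp add: vec_eq_iff forall_3 matrix_vector_mult_nth_3 det_3 transpose_def algebra_simps)

text \<open>A basis of \<open>J\<close> stays independent after adding some \<open>y\<close> outside
  \<open>J\<close>, so some linear functional kills \<open>J\<close> and is 1 at \<open>y\<close>;
  \<open>c\<close> is its coefficient vector.\<close>

lemma proper_subspace_annihilator:
  fixes J :: "('f::field^'n) set"
  assumes J: "vec.subspace J" and "J \<noteq> UNIV"
  obtains c :: "'f^'n" where "c \<noteq> 0" "\<And>x. x \<in> J \<Longrightarrow> (\<Sum>i\<in>UNIV. c$i * x$i) = 0"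
proof -
  obtain B where B: "B \<subseteq> J" "vec.independent B" "J \<subseteq> vec.span B"
    using vec.basis_exists by metis
  obtain y where y: "y \<notin> J" using assms(2) by auto
  have "y \<notin> vec.span B" using vec.span_minimal[OF B(1) J] y by auto
  then have "vec.independent (insert y B)"
    using B(2) by (simp add: vec.independent_insert)
  \<comment> \<open>The codomain \<open>'f^1\<close> makes the functional a matrix with a single
    row.\<close>
  then obtain g :: "'f^'n \<Rightarrow> 'f^1" where
    g: "Vector_Spaces.linear (*s) (*s) g" "\<forall>x\<in>insert y B. g x = (if x = y then 1 else 0)"
    using vec.linear_independent_extend[of "insert y B" "\<lambda>x. if x = y then 1 else 0"] by blast
  define c where "c = matrix g $ 1"
  have c: "(\<Sum>i\<in>UNIV. c$i * x$i) = g x $ 1" for x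
    unfolding c_def by (subst matrix_works[OF g(1), symmetric]) (simp add: matrix_vector_mult_def)
  have "g x = 0" if "x \<in> J" for x
    using vec.linear_eq_0_on_span[OF g(1)] g(2) B y that by (metis insert_iff subsetD)
  moreover have "c \<noteq> 0" using c[of y] g(2) by auto
  ultimately show thesis using that[of c] c by simp
qed

section \<open>Simplicity and twisting maps in coordinates\<close>

text \<open>Equivalently, \<open>\<phi>\<close> is an isomorphism from \<open>A\<close> onto the
  twist of \<open>so3\<close> by \<open>M\<close>.\<close>

locale coordinatized =
  fixes A :: "('f::field, 'a::ab_group_add) algebra" and \<phi> :: "'a \<Rightarrow> 'f^3" and M :: "'f^3^3"
  assumes anticommutative: "anticommutative A"
    and linear: "linear_map A so3 \<phi>"
    and bij: "bij \<phi>"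
    and brk: "\<phi> (brk A x y) = M *v brk so3 (\<phi> x) (\<phi> y)"
begin

sublocale V: vector_space "scl A"
  using anticommutative by (simp add: anticommutative_def)

lemma add [simp]: "\<phi> (x + y) = \<phi> x + \<phi> y" and scale [simp]: "\<phi> (scl A c x) = c *s \<phi> x"
  using linear by (simp_all add: linear_map_iff)

lemma zero [simp]: "\<phi> 0 = 0"
  using add[of 0 0] by simp

lemma eq_iff [simp]: "\<phi> x = \<phi> y \<longleftrightarrow> x = y"
  using bij by (auto simp: bij_def inj_eq)

lemma surj: obtains x where "\<phi> x = v"
  using bij by (metis bij_pointE)

text \<open>Each basis vector is a cross product, so a zero bracket makes \<open>M\<close> kill a
  basis.\<close>

lemma abelian_iff: "abelian A \<longleftrightarrow> M = 0"
proof
  assume "abelian A"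
  then have "M *v brk so3 (\<phi> x) (\<phi> y) = 0" for x y
    by (simp add: abelian_def flip: brk)
  then have "M *v brk so3 u v = 0" for u v by (metis surj)
  then have "M *v axis 1 1 = 0" "M *v axis 2 1 = 0" "M *v axis 3 1 = 0"
    by (metis so3_basis)+
  then show "M = 0"
    by (simp add: vec_eq_iff forall_3 matrix_vector_mult_nth_3) (simp add: axis_def)
next
  assume "M = 0"
  then show "abelian A"
    unfolding abelian_def by (metis brk eq_iff matrix_vector_mult_0 zero)
qed

text \<open>A proper ideal has an image \<open>J\<close> killed by some \<open>c\<close>, which
  forces \<open>J\<close> into the line of \<open>d\<close>. For nonzero \<open>u\<close> in
  \<open>J\<close>, the products of \<open>u\<close> with basis vectors also lie in
  \<open>J\<close>, and they cannot all be parallel.\<close>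

lemma simple_if_invertible:
  assumes M: "invertible M"
  shows "simple A"
proof -
  have det: "det M \<noteq> 0" using M by (simp add: invertible_det_nz)
  have "I = UNIV" if I: "ideal A I" "I \<noteq> {0}" for I
  proof (rule ccontr)
    assume "I \<noteq> UNIV"
    define J where "J = \<phi> ` I"
    have sub: "V.subspace I" and br: "\<And>x y. x \<in> I \<Longrightarrow> brk A x y \<in> I"
      using I(1) by (auto simp: ideal_def)
    have "c *s \<phi> x \<in> \<phi> ` I" if "x \<in> I" for c x
      using sub that by (metis V.subspace_scale imageI scale)
    moreover have "\<phi> x + \<phi> y \<in> \<phi> ` I" if "x \<in> I" "y \<in> I" for x y
      using sub that by (metis V.subspace_add imageI add)
    moreover have "0 \<in> \<phi> ` I" using sub by (metis V.subspace_0 imageI zero)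
    ultimately have subJ: "vec.subspace J"
      unfolding J_def vec.subspace_def by auto
    have brJ: "M *v brk so3 u v \<in> J" if "u \<in> J" for u v
    proof -
      obtain x y where "x \<in> I" "u = \<phi> x" "v = \<phi> y" using \<open>u \<in> J\<close> surj[of v] J_def by (metis imageE)
      then show ?thesis unfolding J_def using br[of x y] brk by (metis imageI)
    qed
    have "J \<noteq> UNIV"
      using \<open>I \<noteq> UNIV\<close> bij unfolding J_def by (metis bij_is_inj bij_is_surj inj_image_eq_iff)
    then obtain c :: "'f^3" where c: "c \<noteq> 0" "\<And>u. u \<in> J \<Longrightarrow> c$1 * u$1 + c$2 * u$2 + c$3 * u$3 = 0"
      using proper_subspace_annihilator[OF subJ] unfolding sum_3 by blast
    define d where "d = transpose M *v c"
    have "invertible (transpose M)" using M by (simp add: invertible_det_nz)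
    then have "d \<noteq> 0"
      using c(1) unfolding d_def
      by (metis invertible_eq_bij bij_is_inj injD matrix_vector_mult_0_right)
    have du: "brk so3 d u = 0" if "u \<in> J" for u
    proof -
      \<comment> \<open>Triple product: \<open>(d \<times> u) \<cdot> v = d \<cdot> (u \<times> v) =
        c \<cdot> M(u \<times> v) = 0\<close>.\<close>
      have "(brk so3 d u)$1 * v$1 + (brk so3 d u)$2 * v$2 + (brk so3 d u)$3 * v$3 = 0" for v :: "'f^3"
        using c(2)[OF brJ[OF that, of v]]
        by (simp add: d_def matrix_vector_mult_nth_3 transpose_def algebra_simps)
      from this[of "axis 1 1"] this[of "axis 2 1"] this[of "axis 3 1"]
      show ?thesis by (simp add: vec_eq_iff forall_3 axis_def)
    qed
    have uw: "brk so3 u w = 0" if "u \<in> J" "w \<in> J" for u w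
    proof -
      have e: "d$2*u$3 = d$3*u$2" "d$3*u$1 = d$1*u$3" "d$1*u$2 = d$2*u$1"
        "d$2*w$3 = d$3*w$2" "d$3*w$1 = d$1*w$3" "d$1*w$2 = d$2*w$1"
        using du[OF that(1)] du[OF that(2)] by (simp_all add: vec_eq_iff forall_3)
      \<comment> \<open>Two vectors parallel to \<open>(a, b, c)\<close> with
        \<open>a \<noteq> 0\<close> are parallel to each other; the other cases below rotate the
        coordinates cyclically.\<close>
      have *: "q*z = r*y \<and> r*x = p*z \<and> p*y = q*x"
        if "a \<noteq> 0" and e: "b*r = c*q" "c*p = a*r" "a*q = b*p" "b*z = c*y" "c*x = a*z" "a*y = b*x"
        for a b c p q r x y z :: 'f
      proof -
        have "a*(q*z) = p*(b*z)" "a*(r*y) = p*(c*y)" using e(2,3) by (metis mult.assoc mult.commute)+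
        moreover have "a*(r*x) = p*(c*x)" "a*(p*z) = p*(c*x)" using e(2,5) by (metis mult.assoc mult.commute)+
        moreover have "a*(p*y) = p*(b*x)" "a*(q*x) = p*(b*x)" using e(3,6) by (metis mult.assoc mult.commute)+
        ultimately show ?thesis using e(4) \<open>a \<noteq> 0\<close> by (metis mult_left_cancel)
      qed
      consider "d$1 \<noteq> 0" | "d$2 \<noteq> 0" | "d$3 \<noteq> 0"
        using \<open>d \<noteq> 0\<close> by (auto simp: vec_eq_iff forall_3)
      then have "u$2*w$3 = u$3*w$2 \<and> u$3*w$1 = u$1*w$3 \<and> u$1*w$2 = u$2*w$1"
      proof cases
        case 1 show ?thesis using *[OF 1 e] by simp
      next
        case 2 show ?thesis using *[OF 2 e(2,3,1,5,6,4)] by simp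
      next
        case 3 show ?thesis using *[OF 3 e(3,1,2,6,4,5)] by simp
      qed
      then show ?thesis by (simp add: vec_eq_iff forall_3)
    qed
    obtain u where u: "u \<in> J" "u \<noteq> 0"
    proof -
      have "0 \<in> I" using sub by (rule V.subspace_0)
      then obtain x where "x \<in> I" "x \<noteq> 0" using I(2) by blast
      then have "\<phi> x \<in> J" "\<phi> x \<noteq> 0" using eq_iff[of x 0] by (auto simp: J_def)
      then show thesis by (rule that)
    qed
    have "det M *s brk so3 (brk so3 u v) (brk so3 u w) = 0" for v w
      using uw[OF brJ[OF u(1), of v] brJ[OF u(1), of w]]
      by (simp flip: transpose_mult_brk_so3)
    then have *: "brk so3 (brk so3 u v) (brk so3 u w) = 0" for v w
      using det by simp
    \<comment> \<open>\<open>(u \<times> v) \<times> (u \<times> w) = det(u, v, w) u\<close>, and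
      for two basis vectors the factor is a coordinate of \<open>u\<close>.\<close>
    have "u$1 * u$1 = 0" "u$2 * u$2 = 0" "u$3 * u$3 = 0"
      using *[of "axis 2 1" "axis 3 1"] *[of "axis 3 1" "axis 1 1"] *[of "axis 1 1" "axis 2 1"]
      by (simp_all add: vec_eq_iff forall_3 axis_def)
    then show False using u(2) by (simp add: vec_eq_iff forall_3)
  qed
  moreover have "M \<noteq> 0" using det by (auto simp: det_3)
  ultimately show ?thesis unfolding simple_def abelian_iff by auto
qed

text \<open>As \<open>\<sigma>\<close> sends brackets to brackets, their span \<open>D\<close> is
  \<open>\<sigma>\<close>-stable. In coordinates \<open>D\<close> lies in the range of
  \<open>M\<close>, so \<open>D = UNIV\<close> makes \<open>M\<close> onto.\<close>

lemma invertible_if_hom_simple: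
  assumes \<sigma>: "linear_map A A \<sigma>" "multiplicative A \<sigma>" "hom_simple A \<sigma>"
  shows "invertible M"
proof -
  define D where "D = V.span {brk A x y | x y. True}"
  have base: "brk A x y \<in> D" for x y
    unfolding D_def by (rule V.span_base) auto
  have "D \<subseteq> {x. \<sigma> x \<in> D}"
    unfolding D_def
  proof (rule V.span_minimal)
    show "{brk A x y |x y. True} \<subseteq> {x. \<sigma> x \<in> V.span {brk A x y |x y. True}}"
      using \<sigma>(2) base by (auto simp: multiplicative_def D_def)
    have "\<sigma> (x + y) = \<sigma> x + \<sigma> y" "\<sigma> (scl A c x) = scl A c (\<sigma> x)" for x y c
      using \<sigma>(1) by (simp_all add: linear_map_iff)
    moreover from this(1)[of 0 0] have "\<sigma> 0 = 0" by simp
    ultimately show "V.subspace {x. \<sigma> x \<in> V.span {brk A x y |x y. True}}"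
      by (simp add: V.subspace_def V.span_zero V.span_add V.span_scale)
  qed
  then have "hom_ideal A \<sigma> D"
    using base by (auto simp: hom_ideal_def) (simp add: D_def)
  moreover have "D \<noteq> {0}"
    using \<sigma>(3) base by (auto simp: hom_simple_def abelian_def)
  ultimately have "D = UNIV" using \<sigma>(3) by (auto simp: hom_simple_def)
  moreover have "D \<subseteq> {x. \<exists>w. \<phi> x = M *v w}"
    unfolding D_def
  proof (rule V.span_minimal)
    show "{brk A x y |x y. True} \<subseteq> {x. \<exists>w. \<phi> x = M *v w}" using brk by auto
    show "V.subspace {x. \<exists>w. \<phi> x = M *v w}"
      unfolding V.subspace_def
    proof (intro conjI ballI allI)
      show "0 \<in> {x. \<exists>w. \<phi> x = M *v w}"
        by (auto intro: exI[of _ 0])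
      show "x + y \<in> {x. \<exists>w. \<phi> x = M *v w}"
        if "x \<in> {x. \<exists>w. \<phi> x = M *v w}" "y \<in> {x. \<exists>w. \<phi> x = M *v w}" for x y
        using that by (auto simp flip: matrix_vector_right_distrib)
      show "scl A c x \<in> {x. \<exists>w. \<phi> x = M *v w}"
        if "x \<in> {x. \<exists>w. \<phi> x = M *v w}" for c x
        using that by (auto simp flip: vec.scale)
    qed
  qed
  ultimately have "\<exists>w. \<phi> x = M *v w" for x
    by blast
  then have "\<exists>w. v = M *v w" for v
    using surj[of v] by metis
  then have "\<exists>B. M ** B = mat 1"
    unfolding matrix_right_invertible_surjective surj_def by auto
  then show ?thesis by (simp add: invertible_right_inverse)
qed

lemma bij_twisting_map:
  assumes "invertible M"
  shows "\<exists>\<sigma>\<in>HS A. bij \<sigma>"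
proof -
  obtain N where N: "transpose M ** N = mat 1"
    using assms by (metis det_transpose invertible_det_nz invertible_right_inverse)
  then have "invertible N" unfolding invertible_left_inverse by auto
  \<comment> \<open>In coordinates \<open>\<sigma>\<close> is \<open>N\<close>, the inverse
    transpose of \<open>M\<close>.\<close>
  define \<sigma> where "\<sigma> = inv \<phi> \<circ> ((*v) N \<circ> \<phi>)"
  have \<sigma>: "\<phi> (\<sigma> x) = N *v \<phi> x" for x
    by (simp add: \<sigma>_def bij bij_is_surj surj_f_inv_f)
  have "bij \<sigma>"
    unfolding \<sigma>_def using \<open>invertible N\<close> bij
    by (intro bij_comp) (simp_all add: bij_imp_bij_inv invertible_eq_bij)
  moreover have "\<sigma> \<in> HS A"
  proof -
    have "linear_map A A \<sigma>"
      unfolding linear_map_iff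
      by (simp add: V.vector_space_axioms \<sigma> vec.add vec.scale flip: eq_iff)
    moreover have "brk A (\<sigma> x) (brk A y z) + brk A (\<sigma> y) (brk A z x) + brk A (\<sigma> z) (brk A x y) = 0"
      for x y z
    proof -
      let ?c = "brk (so3 :: ('f, 'f^3) algebra)"
      have t: "M *v ?c (transpose M *v v) (transpose M *v w) = det M *s ?c v w" for v w
        using transpose_mult_brk_so3[of "transpose M" v w] by simp
      have "transpose M *v (N *v v) = v" for v
        by (simp add: matrix_vector_mul_assoc N)
      \<comment> \<open>This turns the inner bracket into a cross product of the vectors
        \<open>N *v _\<close>, so that the twisting identity becomes the Jacobi identity for
        \<open>so3\<close>.\<close>
      then have MN: "M *v ?c v w = det M *s ?c (N *v v) (N *v w)" for v w
        by (metis t)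
      have s: "?c u (k *s v) = k *s ?c u v" for u v k
        by (simp add: vec_eq_iff forall_3 algebra_simps)
      let ?X = "N *v \<phi> x" and ?Y = "N *v \<phi> y" and ?Z = "N *v \<phi> z"
      have "\<phi> (brk A (\<sigma> x) (brk A y z) + brk A (\<sigma> y) (brk A z x) + brk A (\<sigma> z) (brk A x y))
        = M *v (det M *s (?c ?X (?c ?Y ?Z) + ?c ?Y (?c ?Z ?X) + ?c ?Z (?c ?X ?Y)))"
        by (simp add: brk \<sigma> MN[of "\<phi> y"] MN[of "\<phi> z"] MN[of "\<phi> x"] s vec.add vec.scale
            vector_add_ldistrib)
      also have "?c ?X (?c ?Y ?Z) + ?c ?Y (?c ?Z ?X) + ?c ?Z (?c ?X ?Y) = 0"
        using lie_algebra_so3[where 'f='f] unfolding lie_algebra_def by blast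
      finally show ?thesis by (simp flip: eq_iff)
    qed
    ultimately show ?thesis by (simp add: HS_def)
  qed
  ultimately show ?thesis by blast
qed

end

section \<open>A bracket whose multiplicative twisting maps are all singular\<close>

text \<open>For the algebra with \<open>[e\<^sub>2,e\<^sub>3] = -e\<^sub>2-e\<^sub>3\<close>, \<open>[e\<^sub>3,e\<^sub>1] = e\<^sub>1+e\<^sub>3\<close>, \<open>[e\<^sub>1,e\<^sub>2] = e\<^sub>1\<close>
  and the linear map \<open>\<sigma>\<close> with columns \<open>\<sigma> e\<^sub>i = (x\<^sub>i, y\<^sub>i, z\<^sub>i)\<close>, \<open>h\<close> says that \<open>\<sigma>\<close> is a twisting map,
  \<open>b\<close>, \<open>c\<close>, \<open>a\<close> that it is multiplicative, and \<open>D\<close> is its determinant. The entries of the cofactor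
  matrix become linear in \<open>\<sigma>\<close>, so the cofactor relations determine \<open>\<sigma>\<^sup>2\<close> up to the factor \<open>D\<close>
  (\<open>r1\<close>, \<open>r2\<close>, \<open>r3\<close>), and \<open>\<sigma>\<close> commutes with \<open>\<sigma>\<^sup>2\<close>.\<close>

lemma twisting_endomorphism_det_eq_0:
 fixes x1 y1 z1 x2 y2 z2 x3 y3 z3 :: "'f::field"
 assumes h: "y2+y3 = -x1" "z2+z3 = x2 - x1" "z1 = y1 - y2"
 and b: "-(x2+x3) = (z2*x3-x2*z3)+(x2*y3-y2*x3)" "-(y2+y3) = -(y2*z3-z2*y3)"
    "-(z2+z3) = -(y2*z3-z2*y3)+(z2*x3-x2*z3)"
 and c: "x1+x3 = (z3*x1-x3*z1)+(x3*y1-y3*x1)" "y1+y3 = -(y3*z1-z3*y1)"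
    "z1+z3 = -(y3*z1-z3*y1)+(z3*x1-x3*z1)"
 and a: "x1 = (z1*x2-x1*z2)+(x1*y2-y1*x2)" "y1 = -(y1*z2-z1*y2)"
    "z1 = -(y1*z2-z1*y2)+(z1*x2-x1*z2)"
 and D: "D = x1*(y2*z3-z2*y3) + y1*(z2*x3-x2*z3) + z1*(x2*y3-y2*x3)"
 shows "D = 0"
proof (rule ccontr)
  assume D0: "D \<noteq> 0"
  \<comment> \<open>The cross products of columns 2, 3 and of columns 1, 2 are minus the first and
    second rows of \<open>\<sigma>\<close>.\<close>
  have b': "y2*z3-z2*y3 = -x1" "z2*x3-x2*z3 = -x2" "x2*y3-y2*x3 = -x3"
    using h b by algebra+
  have a': "y1*z2-z1*y2 = -y1" "z1*x2-x1*z2 = -y2" "x1*y2-y1*x2 = -y3"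
    using h a by algebra+
  have c': "y3*z1-z3*y1 = -(y1+y3)" "z3*x1-x3*z1 = x1+z3" "x3*y1-y3*x1 = x3-z3"
    using h c by algebra+
  \<comment> \<open>Pairing these cross products with the three columns gives 0 or \<open>D\<close>,
    hence the first two rows of \<open>\<sigma>\<^sup>2\<close>.\<close>
  have r1: "x1*x1+x2*y1+x3*z1 = -D" "x1*x2+x2*y2+x3*z2 = 0" "x1*x3+x2*y3+x3*z3 = 0"
    using b' D by algebra+
  have r2: "y1*x1+y2*y1+y3*z1 = 0" "y1*x2+y2*y2+y3*z2 = 0" "y1*x3+y2*y3+y3*z3 = -D"
    using b' D a' by algebra+
  \<comment> \<open>The second row of \<open>\<sigma>\<close> against the cofactors of the first row
    gives 0; against its own, in \<open>k2\<close>, it gives \<open>D\<close>.\<close>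
  have "(y2*z3-z2*y3)*y1 + (y3*z1-z3*y1)*y2 + (y1*z2-z1*y2)*y3 = 0"
    by (simp add: algebra_simps)
  then have k1: "x1*y1 + (y1+y3)*y2 + y1*y3 = 0"
    unfolding b' a' c' by algebra
  have "(z2*x3-x2*z3)*y1 + (z3*x1-x3*z1)*y2 + (z1*x2-x1*z2)*y3 = D"
    unfolding D by (simp add: algebra_simps)
  then have k2: "(x1+z3)*y2 - x2*y1 - y2*y3 = D"
    unfolding b' a' c' by (simp add: algebra_simps)
  have "(x1 + y2 + y3)*y1 + y2*y3 = 0" using k1 by (simp add: algebra_simps)
  then have y23: "y2*y3 = 0" using h(1) by (simp add: add.assoc)
  have z2: "z2 = x2 - x1 - z3" using h(2) by (simp add: algebra_simps)
  have "z1*x1+z2*y1+z3*z1 = y2*(-x1-z3) + x2*y1"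
    unfolding h(3) z2 by (simp add: algebra_simps)
  also have "\<dots> = -D" using k2 y23 by (simp add: algebra_simps)
  finally have r3: "z1*x1+z2*y1+z3*z1 = -D" .
  \<comment> \<open>The (1,1) entry of
    \<open>\<sigma> \<sigma>\<^sup>2 = \<sigma>\<^sup>2 \<sigma>\<close>; the (1,3) entry then
    yields \<open>x2 = 0\<close>.\<close>
  have "x3 * (z1*x1+z2*y1+z3*z1)
      = (x1*x1+x2*y1+x3*z1)*x1 + (x1*x2+x2*y2+x3*z2)*y1 + (x1*x3+x2*y3+x3*z3)*z1
        - x1*(x1*x1+x2*y1+x3*z1) - x2*(y1*x1+y2*y1+y3*z1)"
    by (simp add: algebra_simps)
  then have x3: "x3 = 0" using D0 by (simp add: r1 r2 r3)
  have "x2 * (y1*x3+y2*y3+y3*z3) = (x1*x1+x2*y1+x3*z1)*x3 + (x1*x2+x2*y2+x3*z2)*y3 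
       + (x1*x3+x2*y3+x3*z3)*z3 - x1*(x1*x3+x2*y3+x3*z3) - x3*(z1*x3+z2*y3+z3*z3)"
    by (simp add: algebra_simps)
  then have "x2 * (-D) = 0"
    unfolding r1 r2 unfolding x3 by simp
  then have x2: "x2 = 0" using D0 by simp
  have x1: "x1 \<noteq> 0" using r1(1) D0 x2 x3 by auto
  have "x1*y2 = -y3" using a'(3) x2 by simp
  then have "y2 = 0 \<and> y3 = 0" using y23 x1 by auto
  then show False using h(1) x1 by simp
qed

section \<open>Coordinates in dimension three\<close>

lemma three_dim_coordinatized:
  fixes A :: "('f::field, 'a::ab_group_add) algebra"
  assumes A: "anticommutative A" and dim: "dimension A = 3"
  obtains \<phi> M where "coordinatized A \<phi> M"
proof -
  interpret V: vector_space "scl A"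
    using A by (simp add: anticommutative_def)
  obtain B where "V.independent B" "UNIV \<subseteq> V.span B" "card B = 3"
    using V.basis_exists[of UNIV] dim unfolding dimension_def by metis
  then obtain b1 b2 b3 where distinct: "b1 \<noteq> b2" "b1 \<noteq> b3" "b2 \<noteq> b3"
    and ind: "V.independent {b1, b2, b3}" and span: "\<And>x. x \<in> V.span {b1, b2, b3}"
    unfolding card_3_iff by blast
  define R where "R = V.representation {b1, b2, b3}"
  define \<phi> :: "'a \<Rightarrow> 'f^3" where "\<phi> x = vector [R x b1, R x b2, R x b3]" for x
  have \<phi>_nth [simp]: "\<phi> x $ 1 = R x b1" "\<phi> x $ 2 = R x b2" "\<phi> x $ 3 = R x b3" for x
    by (simp_all add: \<phi>_def)
  have R_add [simp]: "R (x + y) b = R x b + R y b" for x y b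
    by (simp add: R_def V.representation_add ind span)
  have R_scale [simp]: "R (scl A c x) b = c * R x b" for c x b
    by (simp add: R_def V.representation_scale ind span)
  have R_basis [simp]: "R b1 b = (if b = b1 then 1 else 0)" "R b2 b = (if b = b2 then 1 else 0)"
    "R b3 b = (if b = b3 then 1 else 0)" for b
    by (simp_all add: R_def V.representation_basis ind)
  have expand: "scl A (R x b1) b1 + scl A (R x b2) b2 + scl A (R x b3) b3 = x" for x
    using V.sum_representation_eq[OF ind span, of "{b1, b2, b3}" x] distinct
    by (simp add: R_def add.assoc)
  have "linear_map A so3 \<phi>"
    unfolding linear_map_iff
    by (simp add: V.vector_space_axioms vec.vector_space_axioms vec_eq_iff forall_3)
  moreover have "bij \<phi>"
  proof (rule bijI')
    show "\<phi> x = \<phi> y \<longleftrightarrow> x = y" for x y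
      using expand[of x] expand[of y] \<phi>_nth by metis
    show "\<exists>x. v = \<phi> x" for v
      by (rule exI[of _ "scl A (v$1) b1 + scl A (v$2) b2 + scl A (v$3) b3"])
        (use distinct in \<open>auto simp: vec_eq_iff forall_3\<close>)
  qed
  moreover
  \<comment> \<open>The columns of \<open>M\<close> are forced by \<open>e2 \<times> e3 = e1\<close>
    and its cyclic shifts.\<close>
  define M :: "'f^3^3"
    where "M = transpose (vector [\<phi> (brk A b2 b3), \<phi> (brk A b3 b1), \<phi> (brk A b1 b2)])"
  have "\<phi> (brk A x y) = M *v brk so3 (\<phi> x) (\<phi> y)" for x y
  proof -
    have add: "brk A (u + v) w = brk A u w + brk A v w" "brk A w (u + v) = brk A w u + brk A w v"
      and scale: "brk A (scl A c u) w = scl A c (brk A u w)" "brk A w (scl A c u) = scl A c (brk A w u)"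
      and self: "brk A u u = 0" for u v w c
      using A by (simp_all add: anticommutative_def linear_map_iff)
    have "brk A u v + brk A v u = 0" for u v
      using self[of "u + v"] unfolding add by (simp add: self add.commute)
    then have anti: "brk A u v = - brk A v u" for u v
      by (simp add: eq_neg_iff_add_eq_0)
    have R_zero: "R 0 b = 0" and R_minus: "R (- x) b = - R x b"
      and R_diff: "R (x - y) b = R x b - R y b" for x y b
      by (simp_all add: R_def V.representation_zero V.representation_neg V.representation_diff ind span)
    have "\<phi> (brk A x y) = \<phi> (brk A (scl A (R x b1) b1 + scl A (R x b2) b2 + scl A (R x b3) b3)
        (scl A (R y b1) b1 + scl A (R y b2) b2 + scl A (R y b3) b3))"
      by (simp only: expand)
    also have "\<dots> = M *v brk so3 (\<phi> x) (\<phi> y)"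
      unfolding vec_eq_iff forall_3 M_def
      by (simp add: matrix_vector_mult_nth_3 transpose_def add scale self R_zero R_minus R_diff
          anti[of b2 b1] anti[of b3 b2] anti[of b1 b3] algebra_simps)
    finally show ?thesis .
  qed
  ultimately have "coordinatized A \<phi> M"
    using A by unfold_locales
  then show thesis by (rule that)
qed

text \<open>An infinite basis would have \<open>card\<close> 0, so dimension 3 yields a finite
  one.\<close>

lemma finite_dim_if_dimension_3:
  assumes A: "anticommutative A" and dim: "dimension A = 3"
  shows "finite_dim A"
proof -
  interpret V: vector_space "scl A"
    using A by (simp add: anticommutative_def)
  obtain B where "V.independent B" "UNIV \<subseteq> V.span B" "card B = 3"
    using V.basis_exists[of UNIV] dim unfolding dimension_def by metis
  then have "finite_dimensional_vector_space (scl A) B"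
    by unfold_locales (auto intro: card_ge_0_finite)
  then show ?thesis by (auto simp: finite_dim_def)
qed

section \<open>The classes in terms of simplicity\<close>

lemma zero_in_HS:
  assumes "anticommutative A"
  shows "(\<lambda>x. 0) \<in> HS A"
proof -
  interpret V: vector_space "scl A"
    using assms by (simp add: anticommutative_def)
  have "linear_map A A (\<lambda>x. brk A x y)" for y
    using assms by (simp add: anticommutative_def)
  then have "brk A 0 y = 0" for y
    unfolding linear_map_iff by (metis V.scale_zero_left)
  then show ?thesis by (simp add: HS_def linear_map_iff V.vector_space_axioms)
qed

lemma multiplicative_zero: "anticommutative A \<Longrightarrow> multiplicative A (\<lambda>x. 0)"
  by (simp add: multiplicative_def anticommutative_def)

lemma hom_simple_if_simple: "simple A \<Longrightarrow> hom_simple A \<sigma>"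
  by (auto simp: simple_def hom_simple_def ideal_def hom_ideal_def)

context coordinatized
begin

text \<open>The zero map is multiplicative and turns simple into Hom-simple, so
  \<open>invertible_if_hom_simple\<close> applies to it.\<close>

lemma simple_iff_invertible: "simple A \<longleftrightarrow> invertible M"
proof
  assume "simple A"
  moreover have "linear_map A A (\<lambda>x. 0)"
    using zero_in_HS[OF anticommutative] by (simp add: HS_def)
  moreover have "multiplicative A (\<lambda>x. 0)"
    using anticommutative by (rule multiplicative_zero)
  ultimately show "invertible M"
    by (intro invertible_if_hom_simple hom_simple_if_simple)
qed (rule simple_if_invertible)

lemma in_MS_iff: "A \<in> MS \<longleftrightarrow> finite_dim A \<and> simple A"
proof
  assume "A \<in> MS"
  then show "finite_dim A \<and> simple A"
    using invertible_if_hom_simple simple_if_invertible by (auto simp: MS_def HS_def)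
next
  assume "finite_dim A \<and> simple A"
  then show "A \<in> MS"
    using zero_in_HS multiplicative_zero hom_simple_if_simple anticommutative
    unfolding MS_def by blast
qed

text \<open>For the zero map, Hom-ideals are exactly ideals; conversely, every Hom-ideal is an ideal
  whatever the twisting map.\<close>

lemma in_SS_iff: "A \<in> SS \<longleftrightarrow> finite_dim A \<and> simple A"
proof
  assume "A \<in> SS"
  then have "hom_simple A (\<lambda>x. 0)" "finite_dim A"
    using zero_in_HS[OF anticommutative] by (auto simp: SS_def)
  then show "finite_dim A \<and> simple A"
    by (auto simp: simple_def hom_simple_def ideal_def hom_ideal_def image_subset_iff V.subspace_0)
next
  assume "finite_dim A \<and> simple A"
  then show "A \<in> SS"
    using hom_simple_if_simple anticommutative by (auto simp: SS_def simple_def)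
qed

lemma in_PS_iff: "A \<in> PS \<longleftrightarrow> finite_dim A \<and> simple A"
  using in_SS_iff bij_twisting_map simple_iff_invertible by (auto simp: PS_def)

text \<open>Were zero the only twisting map, it would be bijective by
  \<open>bij_twisting_map\<close>, and the space would be trivial.\<close>

lemma in_SS_star_iff: "A \<in> SS_star \<longleftrightarrow> finite_dim A \<and> simple A"
proof -
  have "HS A \<noteq> {\<lambda>x. 0}" if "simple A"
  proof
    assume "HS A = {\<lambda>x. 0}"
    then have "bij (\<lambda>x::'a. 0::'a)"
      using bij_twisting_map that simple_iff_invertible by auto
    then have "x = 0" for x :: 'a
      by (auto simp: bij_def inj_def)
    then show False using that by (auto simp: simple_def abelian_def)
  qed
  then show ?thesis using in_SS_iff by (auto simp: SS_star_def)
qed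

end

section \<open>Twists of the cross product and the counterexample\<close>

lemma so3_twist_coordinatized:
  "coordinatized (yau_twist so3 ((*v) M)) id (M :: 'f::field^3^3)"
proof
  have so3: "vector_space (scl (so3 :: ('f, 'f^3) algebra))" "\<And>y::'f^3. brk so3 y y = 0"
    "\<And>x y z. brk so3 (x + y) z = brk so3 x z + (brk so3 y z :: 'f^3)"
    "\<And>x y z. brk so3 z (x + y) = brk so3 z x + (brk so3 z y :: 'f^3)"
    "\<And>c x z. brk so3 (c *s x) z = c *s (brk so3 x z :: 'f^3)"
    "\<And>c x z. brk so3 z (c *s x) = c *s (brk so3 z x :: 'f^3)"
    using lie_algebra_so3[where 'f='f]
    by (simp_all add: lie_algebra_def anticommutative_def linear_map_iff)
  then show "anticommutative (yau_twist so3 ((*v) M))"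
    by (simp add: anticommutative_def linear_map_iff yau_twist_def vec.add vec.scale)
  show "linear_map (yau_twist so3 ((*v) M)) so3 id"
    using so3(1) by (simp add: linear_map_iff yau_twist_def)
qed (simp_all add: yau_twist_def)

text \<open>On basis vectors, the twisting identity and multiplicativity become the equations of
  \<open>twisting_endomorphism_det_eq_0\<close>, which contradict bijectivity.\<close>

lemma yau_twist_so3_not_in_RS:
  obtains M :: "'f::field^3^3" where "invertible M" "yau_twist so3 ((*v) M) \<notin> RS"
proof -
  \<comment> \<open>Chosen so that \<open>M M\<^sup>-\<^sup>T\<close> has a one-dimensional eigenspace for \<open>-1\<close> in every characteristic,
    also in characteristic \<open>2\<close>, where it is a single Jordan block.\<close>
  define M :: "'f^3^3" where "M = vector [vector [0, 1, 1], vector [-1, 0, 0], vector [-1, 1, 0]]"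
  have M: "(M *v v) $ 1 = v$2 + v$3" "(M *v v) $ 2 = - v$1" "(M *v v) $ 3 = - v$1 + v$2" for v
    by (simp_all add: M_def matrix_vector_mult_nth_3)
  have "det M \<noteq> 0" by (simp add: M_def det_3)
  then have inv: "invertible M" by (simp add: invertible_det_nz)
  have False if "\<sigma> \<in> HS (yau_twist so3 ((*v) M))" "regular (yau_twist so3 ((*v) M)) \<sigma>" for \<sigma>
  proof -
    let ?b = "\<lambda>x y. M *v brk so3 x y"
    let ?e1 = "axis 1 1 :: 'f^3" and ?e2 = "axis 2 1 :: 'f^3" and ?e3 = "axis 3 1 :: 'f^3"
    have lin: "Vector_Spaces.linear (*s) (*s) \<sigma>" and "bij \<sigma>"
      and mult: "\<And>x y. \<sigma> (?b x y) = ?b (\<sigma> x) (\<sigma> y)"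
      using that(2) by (simp_all add: regular_def linear_map_def multiplicative_def yau_twist_def)
    have add: "\<sigma> (x + y) = \<sigma> x + \<sigma> y" and scale: "\<sigma> (c *s x) = c *s \<sigma> x" for x y c
      using lin by (simp_all add: Vector_Spaces.linear_def module_hom_iff)
    have twist: "?b (\<sigma> x) (?b y z) + ?b (\<sigma> y) (?b z x) + ?b (\<sigma> z) (?b x y) = 0" for x y z
      using that(1) by (simp add: HS_def yau_twist_def)
    have e: "?b ?e2 ?e3 = (- 1) *s (?e2 + ?e3)" "?b ?e3 ?e1 = ?e1 + ?e3" "?b ?e1 ?e2 = ?e1"
      by (simp_all add: vec_eq_iff forall_3 M axis_def)
    define s1 s2 s3 where s: "s1 = \<sigma> ?e1" "s2 = \<sigma> ?e2" "s3 = \<sigma> ?e3"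
    have m: "- (s2 + s3) = ?b s2 s3" "s1 + s3 = ?b s3 s1" "s1 = ?b s1 s2"
      using mult[of ?e2 ?e3] mult[of ?e3 ?e1] mult[of ?e1 ?e2] unfolding e add scale s by simp_all
    have m1: "(- (s2 + s3)) $ i = ?b s2 s3 $ i" and m2: "(s1 + s3) $ i = ?b s3 s1 $ i"
      and m3: "s1 $ i = ?b s1 s2 $ i" for i
      by (fact arg_cong[OF m(1)] arg_cong[OF m(2)] arg_cong[OF m(3)])+
    note comps = M brk_so3_nth vector_uminus_component vector_add_component
    \<comment> \<open>The twisting identity at the three basis vectors is
      \<open>M *v ?w = 0\<close>, and the invertible \<open>M\<close> cancels.\<close>
    let ?w = "brk so3 s1 ((- 1) *s (?e2 + ?e3)) + brk so3 s2 (?e1 + ?e3) + brk so3 s3 ?e1"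
    have "M *v ?w = 0" using twist[of ?e1 ?e2 ?e3] unfolding e s by (simp add: vec.add)
    then have "?w = 0"
      using inv by (metis invertible_eq_bij bij_is_inj injD matrix_vector_mult_0_right)
    then have w: "?w $ i = 0" for i by simp
    have "- s1$1 - s2$2 - s3$2 = 0" "s1$1 + (s2$3 - s2$1) + s3$3 = 0" "s1$3 - s1$2 + s2$2 = 0"
      using w[of 3] w[of 2] w[of 1] by (simp_all add: axis_def)
    then have h: "s2$2 + s3$2 = - s1$1" "s2$3 + s3$3 = s2$1 - s1$1" "s1$3 = s1$2 - s2$2"
      by algebra+
    have "det (matrix \<sigma>) = 0"
    proof (rule twisting_endomorphism_det_eq_0[OF h])
      show "- (s2$1 + s3$1) = (s2$3 * s3$1 - s2$1 * s3$3) + (s2$1 * s3$2 - s2$2 * s3$1)"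
        "- (s2$2 + s3$2) = - (s2$2 * s3$3 - s2$3 * s3$2)"
        "- (s2$3 + s3$3) = - (s2$2 * s3$3 - s2$3 * s3$2) + (s2$3 * s3$1 - s2$1 * s3$3)"
        by (fact m1[of 1, unfolded comps] m1[of 2, unfolded comps] m1[of 3, unfolded comps])+
      show "s1$1 + s3$1 = (s3$3 * s1$1 - s3$1 * s1$3) + (s3$1 * s1$2 - s3$2 * s1$1)"
        "s1$2 + s3$2 = - (s3$2 * s1$3 - s3$3 * s1$2)"
        "s1$3 + s3$3 = - (s3$2 * s1$3 - s3$3 * s1$2) + (s3$3 * s1$1 - s3$1 * s1$3)"
        by (fact m2[of 1, unfolded comps] m2[of 2, unfolded comps] m2[of 3, unfolded comps])+
      show "s1$1 = (s1$3 * s2$1 - s1$1 * s2$3) + (s1$1 * s2$2 - s1$2 * s2$1)"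
        "s1$2 = - (s1$2 * s2$3 - s1$3 * s2$2)"
        "s1$3 = - (s1$2 * s2$3 - s1$3 * s2$2) + (s1$3 * s2$1 - s1$1 * s2$3)"
        by (fact m3[of 1, unfolded comps] m3[of 2, unfolded comps] m3[of 3, unfolded comps])+
      show "det (matrix \<sigma>) = s1$1 * (s2$2 * s3$3 - s2$3 * s3$2)
          + s1$2 * (s2$3 * s3$1 - s2$1 * s3$3) + s1$3 * (s2$1 * s3$2 - s2$2 * s3$1)"
        by (simp add: det_3 matrix_def s algebra_simps)
    qed
    moreover have "(*v) (matrix \<sigma>) = \<sigma>"
      using matrix_works[OF lin] by auto
    ultimately show False
      using \<open>bij \<sigma>\<close> by (metis invertible_det_nz invertible_eq_bij)
  qed
  then have "yau_twist so3 ((*v) M) \<notin> RS" by (auto simp: RS_def)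
  with inv show thesis by (rule that)
qed

section \<open>Comparison of the classes\<close>

lemma three_dim_classes:
  fixes A :: "('f::field, 'a::ab_group_add) algebra"
  assumes "anticommutative A" "dimension A = 3"
  shows "A \<in> MS \<longleftrightarrow> simple A" "A \<in> SS \<longleftrightarrow> simple A" "A \<in> PS \<longleftrightarrow> simple A"
    "A \<in> SS_star \<longleftrightarrow> simple A"
proof -
  obtain \<phi> M where "coordinatized A \<phi> M" by (rule three_dim_coordinatized[OF assms])
  then interpret coordinatized A \<phi> M .
  show "A \<in> MS \<longleftrightarrow> simple A" "A \<in> SS \<longleftrightarrow> simple A" "A \<in> PS \<longleftrightarrow> simple A"
    "A \<in> SS_star \<longleftrightarrow> simple A"
    using finite_dim_if_dimension_3[OF assms]
    by (simp_all add: in_MS_iff in_SS_iff in_PS_iff in_SS_star_iff)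
qed

lemma of_dim_3_classes:
  shows "of_dim 3 MS = (of_dim 3 SS :: ('f::field, 'a::ab_group_add) algebra set)"
    and "of_dim 3 PS = (of_dim 3 SS :: ('f::field, 'a::ab_group_add) algebra set)"
    and "of_dim 3 SS_star = (of_dim 3 SS :: ('f::field, 'a::ab_group_add) algebra set)"
    and "of_dim 3 RS \<subseteq> (of_dim 3 SS :: ('f::field, 'a::ab_group_add) algebra set)"
proof -
  have "anticommutative A" if "A \<in> MS \<union> SS \<union> PS \<union> SS_star"
    for A :: "('f, 'a) algebra"
    using that by (auto simp: MS_def SS_def PS_def SS_star_def)
  then show eq: "of_dim 3 MS = (of_dim 3 SS :: ('f, 'a) algebra set)"
    and "of_dim 3 PS = (of_dim 3 SS :: ('f, 'a) algebra set)"
    and "of_dim 3 SS_star = (of_dim 3 SS :: ('f, 'a) algebra set)"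
    using three_dim_classes unfolding of_dim_def by blast+
  \<comment> \<open>Regular twisting maps are multiplicative.\<close>
  have "of_dim 3 RS \<subseteq> (of_dim 3 MS :: ('f, 'a) algebra set)"
    by (auto simp: of_dim_def RS_def MS_def regular_def)
  then show "of_dim 3 RS \<subseteq> (of_dim 3 SS :: ('f, 'a) algebra set)" by (simp only: eq)
qed

text \<open>Strictness is asserted on \<open>'f^3\<close>, since an arbitrary type \<open>'a\<close>
  may carry no three-dimensional algebra and both classes would be empty.\<close>

theorem theorem7p3:
  shows "(\<forall>A :: ('f::field, 'a::ab_group_add) algebra.
           anticommutative A \<and> dimension A = 3 \<and> simple A \<longrightarrow>
           (\<exists>\<theta>. linear_map (so3 :: ('f, 'f^3) algebra) so3 \<theta> \<and> bij \<theta> \<and>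
                isomorphic A (yau_twist so3 \<theta>)))
    \<and> (of_dim 3 RS :: ('f, 'a) algebra set) \<subseteq> of_dim 3 PS
    \<and> (of_dim 3 RS :: ('f, 'f^3) algebra set) \<subset> of_dim 3 PS
    \<and> (of_dim 3 PS :: ('f, 'a) algebra set) = of_dim 3 SS_star
    \<and> (of_dim 3 SS_star :: ('f, 'a) algebra set) = of_dim 3 SS
    \<and> (of_dim 3 SS :: ('f, 'a) algebra set) = of_dim 3 MS"
proof -
  have "\<exists>\<theta>. linear_map (so3 :: ('f, 'f^3) algebra) so3 \<theta> \<and> bij \<theta> \<and> isomorphic A (yau_twist so3 \<theta>)"
    if A: "anticommutative A" "dimension A = 3" "simple A" for A :: "('f, 'a) algebra"
  proof -
    obtain \<phi> M where "coordinatized A \<phi> M" by (rule three_dim_coordinatized[OF A(1,2)])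
    then interpret coordinatized A \<phi> M .
    have "invertible M" using A(3) by (simp add: simple_iff_invertible)
    moreover have "linear_map so3 so3 ((*v) M)"
      by (simp add: linear_map_def)
    moreover have "isomorphic A (yau_twist so3 ((*v) M))"
      unfolding isomorphic_def
      by (rule exI[of _ \<phi>]) (use linear bij brk in \<open>simp add: linear_map_def yau_twist_def\<close>)
    ultimately show ?thesis by (auto simp: invertible_eq_bij)
  qed
  moreover have "(of_dim 3 RS :: ('f, 'f^3) algebra set) \<noteq> of_dim 3 PS"
  proof -
    obtain M :: "'f^3^3" where M: "invertible M" "yau_twist so3 ((*v) M) \<notin> RS"
      by (rule yau_twist_so3_not_in_RS)
    interpret coordinatized "yau_twist so3 ((*v) M)" id M
      by (rule so3_twist_coordinatized)
    have "dimension (yau_twist so3 ((*v) M)) = 3"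
      using dimension_so3[where 'f='f] by (simp add: dimension_def yau_twist_def)
    \<comment> \<open>The twist is simple because \<open>M\<close> is invertible, hence it lies in
      \<open>PS\<close>.\<close>
    then have "yau_twist so3 ((*v) M) \<in> of_dim 3 PS"
      using three_dim_classes(3)[OF anticommutative] M(1)
      by (simp add: of_dim_def simple_iff_invertible)
    then show ?thesis using M(2) by (auto simp: of_dim_def)
  qed
  ultimately show ?thesis
    by (auto simp: of_dim_3_classes psubset_eq)
qed

end
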